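(* Let $\mathcal H\triangleq\{H_x\}_{x\in\mathcal X}\cup\{\Xi\}$, where $H_x=\{\xi\in\Xi: f(\xi,x)<+\infty\}$, and let $\xi^{[N]}=(\xi_1,\dots,\xi_N)$ be IID samples from $\mathbb P$ (so $\xi^{[N]}\sim\mathbb P^N$). Assume $\mathcal H$ has finite VC dimension $d_{VC}(\mathcal H)=d<+\infty$, that the SAA feasible region $\mathrm{dom}\,\hat F_N=\bigcap_{i=1}^N\{x\in\mathcal X: f(\xi_i,x)<+\infty\}$ is non-empty with probability 1, and let $x^\star(\xi^{[N]})\in\mathcal X$ be the output of any algorithm that is guaranteed to be within $\mathrm{dom}\,\hat F_N$. Then for every $0<\epsilon<1$, $$\mathbb P^N\big(V(x^\star(\xi^{[N]}))>\epsilon\big)\ \le\ 2\exp\Big(-\frac{N\epsilon}{4}\Big)\Big(\frac{12}{\epsilon}\Big)^d .$$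
   Context: Setting. $(\Omega,\mathcal F,\mathbb P)$ is a complete probability space and $\xi:\Omega\to\Xi\subseteq\mathbb R^r$ is a random vector ($\mathbb P$ also denotes its law on $\Xi$). $\mathcal X$ is a nonempty closed subset of a Polish space, with Borel $\sigma$-algebra $\mathscr B$. $f$ is a function of $(\xi,x)\in\Xi\times\mathcal X$ with values in $\mathbb R\cup\{+\infty\}$, such that $f(\xi,\cdot)$ is lower semicontinuous for each realization of $\xi$ and $(\omega,x)\mapsto f(\xi(\omega),x)$ is measurable with respect to the completion of $\mathcal F\otimes\mathscr B$. Put $F(x)=\mathbb E[f(\xi,x)]$; the set $\{x\in\mathcal X:F(x)<+\infty\}$ is assumed non-empty. All quantities of interest are assumed measurable. $\mathbb P^N$ is the joint law of $N$ IID samples of $\xi$. The stochastic program is $\inf_{x\in\mathcal X}F(x)$ and its sample average approximation (SAA) is $\inf_{x\in\mathcal X}\hat F_N(x)$ with $\hat F_N(x)=\frac1N\sum_{i=1}^N f(\xi_i,x)$. Write $\mathrm{dom}\,f_\xi=\{x\in\mathcal X:f(\xi,x)<+\infty\}$ and define the violation probability $V(x)=\mathbb P(\xi\in\Xi: x\notin\mathrm{dom}\,f_\xi)$ for $x\in\mathcal X$. VC dimension: a class $\mathcal H$ of subsets of a set shatters a finite set of points $S$ if for every $D\subseteq S$ there is $C\in\mathcal H$ with $D\subseteq C$ and $(S\setminus D)\cap C=\emptyset$; $d_{VC}(\mathcal H)$ is the maximal cardinality of a finite set shattered by $\mathcal H$ ($+\infty$ if unbounded). *)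

theory Defs
  imports "HOL-Probability.Probability"
begin

text \<open>
  Throughout, \<open>M\<close> is the underlying probability space, \<open>\<xi>\<close> the random vector, \<open>Xi\<close> the set in which
  it takes its values, \<open>X\<close> the decision set and \<open>f s x\<close> the integrand at \<open>s \<in> Xi\<close>, \<open>x \<in> X\<close>.
\<close>

definition lsc_on :: "'a::topological_space set \<Rightarrow> ('a \<Rightarrow> ereal) \<Rightarrow> bool" where
  "lsc_on X g \<longleftrightarrow> (\<forall>x\<in>X. g x \<le> Liminf (at x within X) g)"

text \<open>
  The completion of the product of the \<open>\<sigma>\<close>-algebra of \<open>M\<close> with the Borel sets of \<open>X\<close> has to be taken
  with respect to some measure, but \<open>X\<close> carries none. We ask for measurability in the completion for
  every Borel probability measure on \<open>X\<close>. This is implied by plain measurability for the product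
  \<open>\<sigma>\<close>-algebra and by universal measurability.
\<close>

definition jointly_measurable ::
  "'w measure \<Rightarrow> ('w \<Rightarrow> 's) \<Rightarrow> 'a::topological_space set \<Rightarrow> ('s \<Rightarrow> 'a \<Rightarrow> ereal) \<Rightarrow> bool" where
  "jointly_measurable M \<xi> X f \<longleftrightarrow>
     (\<forall>\<mu>. prob_space \<mu> \<and> sets \<mu> = sets (restrict_space borel X) \<longrightarrow>
        (\<lambda>(\<omega>, x). f (\<xi> \<omega>) x) \<in> borel_measurable (completion (M \<Otimes>\<^sub>M \<mu>)))"

text \<open>
  Since \<open>\<infinity> - \<infinity> = \<infinity>\<close> in \<^typ>\<open>ereal\<close>, the expectation is \<open>\<infinity>\<close> whenever the positive part has infinite
  expectation, the usual convention for extended-real integrands in minimization.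
\<close>

definition ereal_expectation :: "'w measure \<Rightarrow> ('w \<Rightarrow> ereal) \<Rightarrow> ereal" where
  "ereal_expectation M g =
     enn2ereal (\<integral>\<^sup>+ \<omega>. e2ennreal (g \<omega>) \<partial>M) - enn2ereal (\<integral>\<^sup>+ \<omega>. e2ennreal (- g \<omega>) \<partial>M)"

definition objective :: "'w measure \<Rightarrow> ('w \<Rightarrow> 's) \<Rightarrow> ('s \<Rightarrow> 'a \<Rightarrow> ereal) \<Rightarrow> 'a \<Rightarrow> ereal" where
  "objective M \<xi> f x = ereal_expectation M (\<lambda>\<omega>. f (\<xi> \<omega>) x)"

definition eff_dom :: "'a set \<Rightarrow> ('a \<Rightarrow> ereal) \<Rightarrow> 'a set" where
  "eff_dom X g = {x \<in> X. g x < \<infinity>}"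

definition saa_objective :: "nat \<Rightarrow> (nat \<Rightarrow> 's) \<Rightarrow> ('s \<Rightarrow> 'a \<Rightarrow> ereal) \<Rightarrow> 'a \<Rightarrow> ereal" where
  "saa_objective N z f x = ereal (1 / real N) * (\<Sum>i<N. f (z i) x)"

definition saa_feasible :: "'a set \<Rightarrow> nat \<Rightarrow> (nat \<Rightarrow> 's) \<Rightarrow> ('s \<Rightarrow> 'a \<Rightarrow> ereal) \<Rightarrow> 'a set" where
  "saa_feasible X N z f = eff_dom X (saa_objective N z f)"

lemma saa_feasible_eq_INT:
  assumes "N > 0"
  shows "saa_feasible X N z f = (\<Inter>i<N. eff_dom X (f (z i)))"
proof -
  have "ereal (1 / real N) * (\<Sum>i<N. f (z i) x) = \<infinity> \<longleftrightarrow> (\<exists>i<N. f (z i) x = \<infinity>)" for x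
  proof -
    have "ereal (1 / real N) * S = \<infinity> \<longleftrightarrow> S = \<infinity>" for S :: ereal
      using assms by (cases S) auto
    then show ?thesis by (auto simp: sum_Pinfty)
  qed
  then show ?thesis
    using assms by (auto simp: saa_feasible_def eff_dom_def saa_objective_def less_top[symmetric]
      top_ereal_def)
qed

definition violation :: "'w measure \<Rightarrow> ('w \<Rightarrow> 's) \<Rightarrow> 'a set \<Rightarrow> ('s \<Rightarrow> 'a \<Rightarrow> ereal) \<Rightarrow> 'a \<Rightarrow> real" where
  "violation M \<xi> X f x = measure M {\<omega> \<in> space M. x \<notin> eff_dom X (f (\<xi> \<omega>))}"

text \<open>The law of \<open>N\<close> IID samples of \<open>\<xi>\<close>, as a complete measure on \<open>{..<N} \<rightarrow>\<^sub>E Xi\<close>.\<close>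

definition sample_law ::
  "'w measure \<Rightarrow> ('w \<Rightarrow> 's::topological_space) \<Rightarrow> 's set \<Rightarrow> nat \<Rightarrow> (nat \<Rightarrow> 's) measure" where
  "sample_law M \<xi> Xi N =
     completion (\<Pi>\<^sub>M i\<in>{..<N}. distr M (restrict_space borel Xi) \<xi>)"

definition shatters :: "'s set set \<Rightarrow> 's set \<Rightarrow> bool" where
  "shatters H S \<longleftrightarrow> (\<forall>D\<subseteq>S. \<exists>C\<in>H. D \<subseteq> C \<and> (S - D) \<inter> C = {})"

definition vc_dim :: "'s set set \<Rightarrow> enat" where
  "vc_dim H = (SUP S\<in>{S. finite S \<and> shatters H S}. enat (card S))"

definition feasibility_class :: "'s set \<Rightarrow> 'a set \<Rightarrow> ('s \<Rightarrow> 'a \<Rightarrow> ereal) \<Rightarrow> 's set set" where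
  "feasibility_class Xi X f = (\<lambda>x. {s \<in> Xi. f s x < \<infinity>}) ` X \<union> {Xi}"

end

theory Submission
  imports Defs
begin

text \<open>
  Double sampling with an independent ghost sample of the same size \<open>N\<close>. If the selected decision has
  violation probability above \<open>\<epsilon>\<close>, then with probability at least \<open>1/2\<close> it is violated by at least
  \<open>3/5 * \<epsilon> * N\<close> ghost points, although it is violated by none of the original points. Exchanging the
  two samples coordinatewise at random, a fixed trace on the \<open>2 * N\<close> points exhibits this behaviour
  with probability at most \<open>2 powr (- 3/5 * \<epsilon> * N)\<close>, and by Sauer--Shelah there are at most
  \<open>(2 * exp 1 * N / d) ^ d\<close> traces. The usual threshold \<open>1/2 * \<epsilon> * N\<close> would not give the exponent \<open>N * \<epsilon> / 4\<close>
  with base \<open>12 / \<epsilon>\<close>; the larger \<open>3/5 * \<epsilon> * N\<close> does, because the claim is trivial for \<open>N * \<epsilon> < 8 * d\<close>.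
\<close>

section \<open>Shattering and the Sauer-Shelah bound on traces\<close>

lemma shattersE:
  assumes "shatters H S" and "D \<subseteq> S"
  obtains C where "C \<in> H" "D \<subseteq> C" "(S - D) \<inter> C = {}"
  using assms unfolding shatters_def by meson

text \<open>Induction over the ground set. Let \<open>F0\<close> be the members without
  \<open>a\<close> and \<open>G\<close> the others with \<open>a\<close> deleted;
  \<open>card F\<close> is the sum of the sizes of \<open>F0 \<union> G\<close> and
  \<open>F0 \<inter> G\<close>. Sets shattered by the union are shattered by \<open>F\<close>; those
  shattered by the intersection stay shattered after adding \<open>a\<close>, since its members
  occur in \<open>F\<close> both with and without \<open>a\<close>. This is Pajor's form of the
  Sauer-Shelah lemma.\<close>

lemma card_le_card_shattered:
  assumes "finite U" and "F \<subseteq> Pow U"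
  shows "card F \<le> card {S. S \<subseteq> U \<and> shatters F S}"
  using assms
proof (induction U arbitrary: F rule: finite_induct)
  case empty
  show ?case
  proof (cases "F = {}")
    case False
    then have "shatters F {}" by (auto simp: shatters_def)
    then have "{S. S \<subseteq> {} \<and> shatters F S} = {{}}" by auto
    moreover have "card F \<le> card {{} :: 'a set}" using empty by (intro card_mono) auto
    ultimately show ?thesis by simp
  qed simp
next
  case (insert a U)
  define F0 where "F0 = {A \<in> F. a \<notin> A}"
  define F1 where "F1 = {A \<in> F. a \<in> A}"
  define G where "G = (\<lambda>A. A - {a}) ` F1"
  have "finite F" 
    using finite_subset[OF insert.prems] insert.hyps(1) by simp
  then have fin: "finite F0" "finite F1" "finite G" by (auto simp: F0_def F1_def G_def)
  have sub: "F0 \<subseteq> Pow U" "G \<subseteq> Pow U" using insert.prems by (auto simp: F0_def F1_def G_def)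
  have inj: "inj_on (insert a) {S. S \<subseteq> U \<and> P S}" for P
    using insert.hyps(2) by (intro inj_onI) (metis (lifting) insert_ident mem_Collect_eq subsetD)
  have disj: "{S. S \<subseteq> U \<and> P S} \<inter> insert a ` {S. S \<subseteq> U \<and> Q S} = {}" for P Q
    using insert.hyps(2) by blast
  have "card G = card F1"
    unfolding G_def by (intro card_image inj_onI) (auto simp: F1_def)
  moreover have "F = F0 \<union> F1" "F0 \<inter> F1 = {}" by (auto simp: F0_def F1_def)
  ultimately have "card F = card F0 + card G" using fin by (simp add: card_Un_disjoint)
  also have "\<dots> = card (F0 \<union> G) + card (F0 \<inter> G)" by (rule card_Un_Int[OF fin(1,3)])
  also have "\<dots> \<le> card {S. S \<subseteq> U \<and> shatters (F0 \<union> G) S} + card {S. S \<subseteq> U \<and> shatters (F0 \<inter> G) S}"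
    using sub by (intro add_mono insert.IH) auto
  also have "\<dots> = card {S. S \<subseteq> U \<and> shatters (F0 \<union> G) S} + card (insert a ` {S. S \<subseteq> U \<and> shatters (F0 \<inter> G) S})"
    using card_image[OF inj] by simp
  also have "\<dots> = card ({S. S \<subseteq> U \<and> shatters (F0 \<union> G) S} \<union> insert a ` {S. S \<subseteq> U \<and> shatters (F0 \<inter> G) S})"
    using insert.hyps(1)
    by (intro card_Un_disjoint[symmetric] disj finite_imageI) auto
  also have "\<dots> \<le> card {S. S \<subseteq> insert a U \<and> shatters F S}"
  proof (rule card_mono)
    have "shatters F S" if S: "S \<subseteq> U" "shatters (F0 \<union> G) S" for S
      unfolding shatters_def
    proof (intro allI impI)
      fix D assume D: "D \<subseteq> S"
      with S(2) obtain C where C: "C \<in> F0 \<union> G" "D \<subseteq> C" "(S - D) \<inter> C = {}"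
        by (rule shattersE)
      have "\<exists>C'\<in>F. C = C' - {a}"
        using C(1)
      proof
        assume "C \<in> F0"
        then have "C \<in> F" "C = C - {a}" unfolding F0_def by simp_all
        then show ?thesis by (rule bexI[rotated])
      next
        assume "C \<in> G"
        then show ?thesis unfolding G_def F1_def by blast
      qed
      then obtain C' where C': "C' \<in> F" "C = C' - {a}"
        by (rule bexE)
      have "D \<subseteq> C'" "(S - D) \<inter> C' = {}" using C(2,3) C'(2) S(1) insert.hyps by blast+
      then show "\<exists>C\<in>F. D \<subseteq> C \<and> (S - D) \<inter> C = {}" using C'(1) by blast
    qed
    moreover have "shatters F (insert a S)" if S: "S \<subseteq> U" "shatters (F0 \<inter> G) S" for S
      unfolding shatters_def
    proof (intro allI impI)
      fix D assume D: "D \<subseteq> insert a S"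
      then have "D - {a} \<subseteq> S" by blast
      with S(2) obtain C where C: "C \<in> F0 \<inter> G" "D - {a} \<subseteq> C" "(S - (D - {a})) \<inter> C = {}"
        by (rule shattersE)
      from C(1) obtain A where A: "A \<in> F1" "C = A - {a}" unfolding G_def by blast
      then have "insert a C = A" unfolding F1_def by blast
      then have CF: "insert a C \<in> F" "C \<in> F" "a \<notin> C"
        using A C(1) unfolding F0_def F1_def by simp_all
      show "\<exists>C\<in>F. D \<subseteq> C \<and> (insert a S - D) \<inter> C = {}"
      proof (cases "a \<in> D")
        case True
        then have "D \<subseteq> insert a C" "(insert a S - D) \<inter> insert a C = {}" using C(2,3) by blast+
        then show ?thesis using CF(1) by blast
      next
        case False
        then have "D \<subseteq> C" "(insert a S - D) \<inter> C = {}" using C(2,3) CF(3) by blast+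
        then show ?thesis using CF(2) by blast
      qed
    qed
    ultimately show "{S. S \<subseteq> U \<and> shatters (F0 \<union> G) S} \<union>
        insert a ` {S. S \<subseteq> U \<and> shatters (F0 \<inter> G) S} \<subseteq> {S. S \<subseteq> insert a U \<and> shatters F S}"
      by blast
    show "finite {S. S \<subseteq> insert a U \<and> shatters F S}"
      using insert.hyps(1) by simp
  qed
  finally show ?case .
qed

lemma card_subsets_card_le:
  assumes "finite U"
  shows "card {S. S \<subseteq> U \<and> card S \<le> d} = (\<Sum>i\<le>d. card U choose i)"
proof -
  have "{S. S \<subseteq> U \<and> card S \<le> d} = (\<Union>i\<le>d. {S. S \<subseteq> U \<and> card S = i})" by auto
  also have "card \<dots> = (\<Sum>i\<le>d. card {S. S \<subseteq> U \<and> card S = i})"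
    using assms by (intro card_UN_disjoint) (auto intro: finite_subset[of _ "Pow U"])
  finally show ?thesis using assms by (simp add: n_subsets)
qed

text \<open>Traces are taken on indices because the points \<open>p j\<close> may repeat. A
  shattered index set cannot contain two indices of the same point, so \<open>p\<close> is injective
  on it and its image is a set of equal size shattered by \<open>H\<close>.\<close>

lemma sauer_shelah_traces:
  fixes p :: "'i \<Rightarrow> 's"
  assumes J: "finite J" and vc: "vc_dim H = enat d"
  shows "card ((\<lambda>C. {j \<in> J. p j \<in> C}) ` H) \<le> (\<Sum>i\<le>d. card J choose i)"
proof -
  let ?F = "(\<lambda>C. {j \<in> J. p j \<in> C}) ` H"
  have "card S \<le> d" if S: "S \<subseteq> J" "shatters ?F S" for S
  proof -
    have inj: "inj_on p S"
    proof (rule inj_onI, rule ccontr)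
      fix i j assume ij: "i \<in> S" "j \<in> S" "p i = p j" "i \<noteq> j"
      then have "{i} \<subseteq> S" by auto
      with S(2) obtain C where "C \<in> ?F" "{i} \<subseteq> C" "(S - {i}) \<inter> C = {}"
        by (rule shattersE)
      then show False using ij S by auto
    qed
    have "shatters H (p ` S)"
      unfolding shatters_def
    proof (intro allI impI)
      fix D assume D: "D \<subseteq> p ` S"
      let ?D = "{j \<in> S. p j \<in> D}"
      have "?D \<subseteq> S" by auto
      with S(2) obtain B where "B \<in> ?F" and B: "?D \<subseteq> B" "(S - ?D) \<inter> B = {}"
        by (rule shattersE)
      then obtain C where "C \<in> H" and C: "B = {j \<in> J. p j \<in> C}" by auto
      have "D \<subseteq> C" "(p ` S - D) \<inter> C = {}" using D B S(1) unfolding C by blast+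
      then show "\<exists>C\<in>H. D \<subseteq> C \<and> (p ` S - D) \<inter> C = {}" using \<open>C \<in> H\<close> by blast
    qed
    moreover have "finite (p ` S)" using S J by (auto intro: finite_subset)
    ultimately have "enat (card (p ` S)) \<le> vc_dim H"
      unfolding vc_dim_def by (intro SUP_upper) auto
    then show ?thesis using vc inj by (simp add: card_image)
  qed
  then have "card {S. S \<subseteq> J \<and> shatters ?F S} \<le> card {S. S \<subseteq> J \<and> card S \<le> d}"
    using J by (intro card_mono) (auto intro: finite_subset[of _ "Pow J"])
  moreover have "card ?F \<le> card {S. S \<subseteq> J \<and> shatters ?F S}"
    using J by (intro card_le_card_shattered) auto
  ultimately show ?thesis using J by (simp add: card_subsets_card_le)
qed

text \<open>With \<open>q = d / n \<le> 1\<close>, the weight \<open>q ^ d\<close> is at most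
  \<open>q ^ i\<close> for \<open>i \<le> d\<close>; the weighted sum extends to the binomial
  expansion of \<open>(1 + q) ^ n\<close>, which is at most \<open>exp 1 ^ d\<close>.\<close>

lemma sum_binomial_le_exp:
  fixes n d :: nat
  assumes "0 < d" "d \<le> n"
  shows "real (\<Sum>i\<le>d. n choose i) \<le> (exp 1 * real n / real d) ^ d"
proof -
  let ?q = "real d / real n"
  have q: "0 < ?q" "?q \<le> 1" using assms by auto
  have "real (\<Sum>i\<le>d. n choose i) * ?q ^ d = (\<Sum>i\<le>d. real (n choose i) * ?q ^ d)"
    by (simp add: sum_distrib_right)
  also have "\<dots> \<le> (\<Sum>i\<le>d. real (n choose i) * ?q ^ i)"
    using q by (intro sum_mono mult_left_mono power_decreasing) auto
  also have "\<dots> \<le> (\<Sum>i\<le>n. real (n choose i) * ?q ^ i)"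
    using q assms by (intro sum_mono2) auto
  also have "\<dots> = (1 + ?q) ^ n"
    using binomial_ring[of ?q 1 n] by (simp add: add.commute)
  also have "\<dots> \<le> exp ?q ^ n"
    using q by (intro power_mono exp_ge_add_one_self) auto
  also have "\<dots> = exp 1 ^ d"
    using assms by (simp flip: exp_of_nat_mult)
  finally show ?thesis using assms
    by (simp add: field_simps power_divide power_mult_distrib)
qed

section \<open>Coordinatewise exchanges of the two half-samples\<close>

text \<open>Positions \<open>j\<close> and \<open>j + N\<close> form a pair, and \<open>S\<close>
  lists the pairs to exchange. For \<open>S \<subseteq> {..<N}\<close> all indices from
  \<open>2 * N\<close> on are fixed.\<close>

definition swap_halves :: "nat \<Rightarrow> nat set \<Rightarrow> nat \<Rightarrow> nat" where
  "swap_halves N S j =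
     (if j < N then if j \<in> S then j + N else j else if j - N \<in> S then j - N else j)"

lemma swap_halves_involution:
  assumes "S \<subseteq> {..<N}"
  shows "swap_halves N S (swap_halves N S j) = j"
  using assms by (auto simp: swap_halves_def subset_eq)

lemma swap_halves_less: "S \<subseteq> {..<N} \<Longrightarrow> j < 2 * N \<Longrightarrow> swap_halves N S j < 2 * N"
  by (auto simp: swap_halves_def)

lemma inj_on_swap_halves: "S \<subseteq> {..<N} \<Longrightarrow> inj_on (swap_halves N S) A"
  by (metis inj_onI swap_halves_involution)

text \<open>
  A swap with no point of the first half outside \<open>D\<close> is forced at every index where one of the two
  positions lies outside \<open>D\<close>, and there are at least \<open>k\<close> such indices.
\<close>

lemma card_good_swaps:
  fixes D :: "nat set"
  shows "card {S. S \<subseteq> {..<N} \<and> (\<forall>j<N. swap_halves N S j \<in> D) \<and>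
           k \<le> card {j \<in> {N..<2 * N}. swap_halves N S j \<notin> D}} * 2 ^ k \<le> 2 ^ N"
    (is "card ?G * _ \<le> _")
proof -
  define G where "G = ?G"
  have "card G * 2 ^ k \<le> 2 ^ N"
  proof (cases "G = {}")
    case False
    define K where "K = {i. i < N \<and> (i \<notin> D \<or> i + N \<notin> D)}"
    have forced: "i \<in> S \<longleftrightarrow> i \<notin> D" if S: "S \<in> G" and i: "i \<in> K" for S i
    proof -
      have "swap_halves N S i \<in> D" using S i by (simp add: G_def K_def)
      then show ?thesis using i by (auto simp: K_def swap_halves_def split: if_splits)
    qed
    have fin: "finite K" by (auto simp: K_def)
    have KN: "K \<subseteq> {..<N}" by (auto simp: K_def)
    obtain S where S: "S \<in> G" using False by blast
    have "card {j \<in> {N..<2 * N}. swap_halves N S j \<notin> D} \<le> card K"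
    proof (rule card_inj_on_le[where f = "\<lambda>j. j - N"])
      show "(\<lambda>j. j - N) ` {j \<in> {N..<2 * N}. swap_halves N S j \<notin> D} \<subseteq> K"
        by (auto simp: K_def swap_halves_def split: if_splits)
    qed (auto intro!: inj_onI simp: fin)
    then have k: "k \<le> card K" using S by (simp add: G_def)
    have kN: "card K \<le> N" using card_mono[OF _ KN] by simp
    have "card G \<le> card (Pow ({..<N} - K))"
    proof (rule card_inj_on_le[where f = "\<lambda>S. S - K"])
      show "inj_on (\<lambda>S. S - K) G"
      proof (rule inj_onI)
        fix S T assume "S \<in> G" "T \<in> G" "S - K = T - K"
        then show "S = T" using forced by blast
      qed
    qed (auto simp: G_def)
    also have "\<dots> = 2 ^ (N - card K)"
      using KN fin by (simp add: card_Pow card_Diff_subset)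
    finally have "card G * 2 ^ k \<le> 2 ^ (N - card K) * 2 ^ card K"
      using k by (intro mult_mono power_increasing) auto
    then show ?thesis using kN by (simp flip: power_add)
  qed simp
  then show ?thesis by (simp add: G_def)
qed

section \<open>Numerical constants and the Chernoff estimate\<close>

text \<open>Supplies the rate \<open>1 - exp (- 1 / 2) \<ge> 39 / 100\<close> of the Chernoff bound.
  The quadratic Taylor bound at \<open>1 / 2\<close> gives only \<open>13 / 8 < 100 / 61\<close>, so
  it is taken at \<open>1 / 4\<close> and squared.\<close>

lemma exp_minus_half_le: "exp (- 1 / 2 :: real) \<le> 61 / 100"
proof -
  have "(41 / 32 :: real) \<le> exp (1 / 4)"
    using exp_lower_Taylor_quadratic[of "1 / 4 :: real"] by (simp add: power2_eq_square)
  then have "(41 / 32 :: real)\<^sup>2 \<le> exp (1 / 4) ^ 2"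
    by (intro power_mono) auto
  also have "\<dots> = exp (1 / 2 :: real)" by (simp flip: exp_of_nat_mult)
  finally have "100 / 61 \<le> exp (1 / 2 :: real)" by (simp add: power2_eq_square)
  then show ?thesis by (simp add: exp_minus field_simps)
qed

text \<open>The value \<open>18 / 25 = 8 * 9 / 100\<close> is the Chernoff exponent reached when
  \<open>card J * \<epsilon> \<ge> 8\<close>.\<close>

lemma exp_minus_72_le: "exp (- 18 / 25 :: real) \<le> 1 / 2"
proof -
  have "(1781 / 1250 :: real) \<le> exp (9 / 25)"
    using exp_lower_Taylor_quadratic[of "9 / 25 :: real"] by (simp add: power2_eq_square)
  then have "(1781 / 1250 :: real)\<^sup>2 \<le> exp (9 / 25) ^ 2"
    by (intro power_mono) auto
  also have "\<dots> = exp (18 / 25 :: real)" by (simp flip: exp_of_nat_mult)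
  finally have "2 \<le> exp (18 / 25 :: real)" by (simp add: power2_eq_square)
  then show ?thesis by (simp add: exp_minus field_simps)
qed

text \<open>Amounts to \<open>exp 11 \<le> 2 ^ 16\<close>.\<close>

lemma ln_2_ge_11_16: "11 / 16 \<le> ln (2 :: real)"
proof -
  have "exp 11 = exp (1 :: real) ^ 11" by (simp flip: exp_of_nat_mult)
  also have "\<dots> \<le> (272 / 100) ^ 11" using e_less_272 by (intro power_mono) auto
  also have "\<dots> \<le> (2 :: real) ^ 16" by (simp add: power_divide)
  finally have "11 \<le> ln ((2 :: real) ^ 16)" by (subst ln_ge_iff) auto
  also have "\<dots> = 16 * ln 2" by (subst ln_realpow) auto
  finally show ?thesis by simp
qed

text \<open>The Chernoff bound with exponential parameter \<open>1/2\<close>.\<close>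

lemma half_le_measure_many_hits:
  fixes M :: "'w measure" and J :: "'i set"
  assumes "prob_space M" and J: "finite J" and B[measurable]: "B \<in> sets M"
    and \<epsilon>: "0 \<le> \<epsilon>" "\<epsilon> \<le> measure M B" and big: "8 \<le> real (card J) * \<epsilon>"
  shows "1 / 2 \<le> measure (PiM J (\<lambda>_. M))
    {y \<in> space (PiM J (\<lambda>_. M)). 3 / 5 * \<epsilon> * real (card J) \<le> real (card {j \<in> J. y j \<in> B})}"
proof -
  interpret M: prob_space M by fact
  interpret P: product_sigma_finite "\<lambda>_. M" by unfold_locales
  interpret R: prob_space "PiM J (\<lambda>_. M)" by (intro prob_space_PiM assms)
  let ?R = "PiM J (\<lambda>_. M)"
  let ?n = "real (card J)"
  define hits where "hits y = (\<Sum>j\<in>J. indicator B (y j) :: real)" for y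
  define g where "g x = exp (- (indicator B x / 2 :: real))" for x
  have hits: "hits y = real (card {j \<in> J. y j \<in> B})" for y
    using J by (simp add: hits_def indicator_def Int_def)
  have [measurable]: "hits \<in> borel_measurable ?R"
    unfolding hits_def by measurable
  have g_meas[measurable]: "g \<in> borel_measurable M" unfolding g_def by measurable
  have g_int: "integrable M g"
    by (rule M.integrable_const_bound[where B = 1]) (auto simp: g_def)
  \<comment> \<open>\<open>g\<close> takes only the values \<open>exp (- 1 / 2)\<close> on
    \<open>B\<close> and 1 off it, so it is affine in the indicator.\<close>
  have "(\<integral>x. g x \<partial>M) = (\<integral>x. 1 - (1 - exp (- 1 / 2)) * indicator B x \<partial>M)"
    by (intro Bochner_Integration.integral_cong) (auto simp: g_def indicator_def)
  also have "\<dots> = 1 - (1 - exp (- 1 / 2)) * measure M B"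
    by (subst Bochner_Integration.integral_diff)
      (auto simp: M.prob_space intro!: integrable_real_indicator simp: less_top[symmetric])
  also have "\<dots> \<le> 1 - 39 / 100 * \<epsilon>"
    using mult_mono[of "39 / 100" "1 - exp (- 1 / 2 :: real)" \<epsilon> "measure M B"]
      exp_minus_half_le \<epsilon> by auto
  also have "\<dots> \<le> exp (- (39 / 100 * \<epsilon>))"
    using exp_ge_add_one_self[of "- (39 / 100 * \<epsilon>)"] by simp
  finally have g_le: "(\<integral>x. g x \<partial>M) \<le> exp (- (39 / 100 * \<epsilon>))" .
  have g_nonneg: "0 \<le> (\<integral>x. g x \<partial>M)" by (intro Bochner_Integration.integral_nonneg) (simp add: g_def)
  define few where "few = {y \<in> space ?R. hits y < 3 / 5 * \<epsilon> * ?n}"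
  have [measurable]: "few \<in> sets ?R" unfolding few_def by measurable
  \<comment> \<open>The exponent is half the hit threshold, so on \<open>few\<close> the product of
    \<open>?c\<close> and \<open>exp (- (hits y / 2))\<close> is at least 1, as in Markov's
    inequality.\<close>
  let ?c = "exp (3 / 10 * \<epsilon> * ?n)"
  have prod_int: "integrable ?R (\<lambda>y. \<Prod>j\<in>J. g (y j))"
    using J g_int by (intro P.product_integrable_prod)
  have "measure ?R few = (\<integral>y. indicator few y \<partial>?R)" by simp
  also have "\<dots> \<le> (\<integral>y. ?c * (\<Prod>j\<in>J. g (y j)) \<partial>?R)"
  proof (rule integral_mono)
    show "indicator few y \<le> ?c * (\<Prod>j\<in>J. g (y j))" if "y \<in> space ?R" for y
    proof (cases "y \<in> few")
      case True
      have "(\<Prod>j\<in>J. g (y j)) = exp (- (hits y / 2))"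
        using J by (simp add: g_def hits_def exp_sum[symmetric] sum_negf sum_divide_distrib)
      then have "?c * (\<Prod>j\<in>J. g (y j)) = exp (3 / 10 * \<epsilon> * ?n - hits y / 2)"
        by (simp add: mult_exp_exp)
      then show ?thesis using True by (simp add: few_def)
    qed (auto simp: g_def intro!: mult_nonneg_nonneg prod_nonneg)
  qed (use prod_int in \<open>auto intro!: integrable_real_indicator simp: less_top[symmetric]\<close>)
  also have "\<dots> = ?c * (\<integral>x. g x \<partial>M) ^ card J"
    using J g_int P.product_integral_prod[of J "\<lambda>_. g"] by simp
  also have "\<dots> \<le> ?c * exp (- (39 / 100 * \<epsilon>)) ^ card J"
    using g_le g_nonneg by (intro mult_left_mono power_mono) auto
  \<comment> \<open>The exponents combine to \<open>3 / 10 - 39 / 100 = - 9 / 100\<close>.\<close>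
  also have "\<dots> = exp (- (9 / 100 * (?n * \<epsilon>)))"
    by (simp add: mult_exp_exp algebra_simps flip: exp_of_nat_mult)
  also have "\<dots> \<le> exp (- 18 / 25)" using big unfolding exp_le_cancel_iff by linarith
  also note exp_minus_72_le
  finally have "1 / 2 \<le> 1 - measure ?R few" by simp
  also have "\<dots> = measure ?R (space ?R - few)" by (simp add: R.prob_compl)
  also have "space ?R - few = {y \<in> space ?R. 3 / 5 * \<epsilon> * ?n \<le> hits y}" by (auto simp: few_def)
  finally show ?thesis by (simp add: hits)
qed

text \<open>In terms of \<open>y = N * \<epsilon> / d\<close> both sides are \<open>d\<close>-th
  powers. What remains is \<open>exp 1 * y * exp (- (3 / 5 * ln 2 * y)) \<le> 6 * exp (- (y /
  4))\<close> for \<open>y \<ge> 8\<close>; the factor \<open>2 / \<epsilon>\<close> turns 6 into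
  \<open>12 / \<epsilon>\<close>.\<close>

lemma vc_numeric_bound:
  fixes N d :: nat and \<epsilon> :: real
  assumes "0 < d" and \<epsilon>: "0 < \<epsilon>" and big: "8 * real d \<le> real N * \<epsilon>"
  shows "(exp 1 * real (2 * N) / real d) ^ d * 2 powr (- (3 / 5 * \<epsilon> * real N))
    \<le> exp (- (real N * \<epsilon> / 4)) * (12 / \<epsilon>) ^ d"
proof -
  define y where "y = real N * \<epsilon> / real d"
  have y: "8 \<le> y" "real N * \<epsilon> = real d * y" "real N = real d * y / \<epsilon>"
    using assms by (auto simp: y_def field_simps)
  \<comment> \<open>Since \<open>ln 2 \<ge> 11 / 16\<close>, the exponent
    \<open>3 / 5 * ln 2 * y - y / 4\<close> is at least \<open>13 / 80 * y = 1 + u\<close>. The goal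
    becomes \<open>y / 6 \<le> exp u\<close>.\<close>
  define u where "u = 13 / 80 * y - 1"
  have "3 / 10 \<le> u" using y by (simp add: u_def)
  \<comment> \<open>With \<open>y = 80 / 13 * (1 + u)\<close>, the difference
    \<open>1 + u + u\<^sup>2 / 2 - y / 6\<close> exceeds this product by
    \<open>(17 * u + 4) / 780\<close>.\<close>
  then have "0 \<le> (u - 3 / 10) * (u / 2 + 4 / 39)" by (intro mult_nonneg_nonneg) auto
  then have "y / 6 \<le> 1 + u + u\<^sup>2 / 2"
    using y(1) by (simp add: u_def field_simps power2_eq_square)
  also have "\<dots> \<le> exp u" using exp_lower_Taylor_quadratic[of u] \<open>3 / 10 \<le> u\<close> by simp
  finally have "y / 6 \<le> exp u" .
  then have "exp 1 * y \<le> 6 * exp (1 + u)" by (simp add: exp_add)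
  also have "1 + u = 13 / 80 * y" by (simp add: u_def)
  also have "13 / 80 * y \<le> 3 / 5 * ln 2 * y - y / 4"
    using mult_right_mono[OF ln_2_ge_11_16, of y] y(1) by simp
  finally have "exp 1 * y \<le> 6 * exp (3 / 5 * ln 2 * y - y / 4)" by simp
  then have "exp 1 * y * exp (- (3 / 5 * ln 2 * y))
      \<le> 6 * exp (3 / 5 * ln 2 * y - y / 4) * exp (- (3 / 5 * ln 2 * y))"
    by (intro mult_right_mono) auto
  also have "\<dots> = 6 * exp (- (y / 4))" by (simp add: mult_exp_exp)
  finally have "exp 1 * y * exp (- (3 / 5 * ln 2 * y)) \<le> 6 * exp (- (y / 4))" .
  from mult_right_mono[OF this, of "2 / \<epsilon>"]
  have *: "exp 1 * (2 * y / \<epsilon>) * exp (- (3 / 5 * ln 2 * y)) \<le> exp (- (y / 4)) * (12 / \<epsilon>)"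
    using \<epsilon> by (simp add: algebra_simps)
  have "(exp 1 * real (2 * N) / real d) ^ d * 2 powr (- (3 / 5 * \<epsilon> * real N))
      = (exp 1 * (2 * y / \<epsilon>)) ^ d * exp (- (3 / 5 * ln 2 * y)) ^ d"
    using \<open>0 < d\<close> y(2,3) by (simp add: powr_def algebra_simps flip: exp_of_nat_mult)
  also have "\<dots> \<le> (exp (- (y / 4)) * (12 / \<epsilon>)) ^ d"
    using * y(1) \<epsilon> by (subst power_mult_distrib[symmetric], intro power_mono) auto
  also have "\<dots> = exp (- (real N * \<epsilon> / 4)) * (12 / \<epsilon>) ^ d"
    unfolding power_mult_distrib y(2) by (simp flip: exp_of_nat_mult)
  finally show ?thesis .
qed

section \<open>Symmetrization with a ghost sample\<close>

text \<open>
  The bad event \<open>A\<close> for the doubled sample is contained in a possibly non-measurable event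
  that depends on \<open>\<C>\<close> only; averaging the indicator of \<open>A\<close> itself over the swaps means that
  this larger event needs no measurability.
\<close>

lemma measure_le_symmetrization:
  fixes M :: "'w measure" and \<C> :: "'w set set" and N k \<Phi> :: nat
  assumes "prob_space M"
    and E[measurable]: "E \<in> sets (PiM {..<N} (\<lambda>_. M))"
    and W[measurable]: "W \<in> sets (PiM {..<N} (\<lambda>_. M) \<Otimes>\<^sub>M M)"
    and ghost: "\<And>\<omega>. \<omega> \<in> E \<Longrightarrow> 1 / 2 \<le> measure (PiM {N..<2 * N} (\<lambda>_. M))
      {y \<in> space (PiM {N..<2 * N} (\<lambda>_. M)). k \<le> card {j \<in> {N..<2 * N}. (\<omega>, y j) \<in> W}}"
    and sep: "\<And>\<omega>. \<omega> \<in> E \<Longrightarrow> \<exists>C\<in>\<C>. (\<forall>i<N. \<omega> i \<in> C) \<and> (\<forall>w\<in>C. (\<omega>, w) \<notin> W)"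
    and growth: "\<And>p. card ((\<lambda>C. {j \<in> {..<2 * N}. p j \<in> C}) ` \<C>) \<le> \<Phi>"
  shows "measure (PiM {..<N} (\<lambda>_. M)) E \<le> 2 * real \<Phi> / 2 ^ k"
proof -
  let ?I = "{..<N}" and ?J = "{N..<2 * N}" and ?K = "{..<2 * N}"
  let ?P = "PiM ?I (\<lambda>_. M)" and ?Q = "PiM ?J (\<lambda>_. M)" and ?R = "PiM ?K (\<lambda>_. M)"
  interpret M: prob_space M by fact
  interpret prod: product_sigma_finite "\<lambda>_. M" by unfold_locales
  interpret PI: prob_space ?P by (intro prob_space_PiM assms)
  interpret PJ: prob_space ?Q by (intro prob_space_PiM assms)
  interpret PK: prob_space ?R by (intro prob_space_PiM assms)
  have IJ: "?I \<union> ?J = ?K" "?I \<inter> ?J = {}" by auto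
  define cnt where "cnt w = (\<Sum>j\<in>?J. indicator W (restrict w ?I, w j) :: real)" for w :: "nat \<Rightarrow> 'w"
  have cnt: "cnt w = real (card {j \<in> ?J. (restrict w ?I, w j) \<in> W})" for w
    by (simp add: cnt_def indicator_def Int_def)
  have [measurable]: "(\<lambda>w. restrict w ?I) \<in> ?R \<rightarrow>\<^sub>M ?P"
    by (intro measurable_restrict_subset) auto
  have [measurable]: "cnt \<in> borel_measurable ?R"
    unfolding cnt_def
  proof (rule borel_measurable_sum)
    fix j assume "j \<in> ?J"
    then have [measurable]: "(\<lambda>w. w j) \<in> ?R \<rightarrow>\<^sub>M M" by (intro measurable_component_singleton) auto
    have "(\<lambda>w. (restrict w ?I, w j)) \<in> ?R \<rightarrow>\<^sub>M ?P \<Otimes>\<^sub>M M" by measurable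
    from measurable_compose[OF this borel_measurable_indicator[OF W]]
    show "(\<lambda>w. indicator W (restrict w ?I, w j) :: real) \<in> borel_measurable ?R" .
  qed
  define A where "A = {w \<in> space ?R. restrict w ?I \<in> E \<and> real k \<le> cnt w}"
  have A[measurable]: "A \<in> sets ?R" unfolding A_def by measurable

  \<comment> \<open>Fubini over original and ghost sample: every section of \<open>A\<close> over a
    point of \<open>E\<close> has mass at least \<open>1 / 2\<close>.\<close>
  have "ennreal (1 / 2) * emeasure ?P E = (\<integral>\<^sup>+x. ennreal (1 / 2) * indicator E x \<partial>?P)"
    by (simp add: nn_integral_cmult)
  also have "\<dots> \<le> (\<integral>\<^sup>+x. emeasure ?Q (Pair x -` (merge ?I ?J -` A \<inter> space (?P \<Otimes>\<^sub>M ?Q))) \<partial>?P)"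
  proof (intro nn_integral_mono)
    fix x assume x: "x \<in> space ?P"
    show "ennreal (1 / 2) * indicator E x
        \<le> emeasure ?Q (Pair x -` (merge ?I ?J -` A \<inter> space (?P \<Otimes>\<^sub>M ?Q)))"
    proof (cases "x \<in> E")
      case True
      let ?B = "{y \<in> space ?Q. k \<le> card {j \<in> ?J. (x, y j) \<in> W}}"
      have eq: "Pair x -` (merge ?I ?J -` A \<inter> space (?P \<Otimes>\<^sub>M ?Q)) = ?B"
      proof -
        have "merge ?I ?J (x, y) \<in> A \<longleftrightarrow> y \<in> ?B" if y: "y \<in> space ?Q" for y
        proof -
          have 1: "restrict (merge ?I ?J (x, y)) ?I = x"
            using x by (auto simp: space_PiM PiE_def extensional_def restrict_def merge_def fun_eq_iff)
          have 2: "{j \<in> ?J. (x, merge ?I ?J (x, y) j) \<in> W} = {j \<in> ?J. (x, y j) \<in> W}"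
            by (auto simp: merge_def)
          have 3: "merge ?I ?J (x, y) \<in> space ?R"
            using measurable_space[OF measurable_merge, of "(x, y)" ?I "\<lambda>_. M" ?J] x y
            unfolding IJ by (auto simp: space_pair_measure)
          show ?thesis using True y 3 unfolding A_def cnt mem_Collect_eq 1 2 by simp
        qed
        then show ?thesis using x by (auto simp: space_pair_measure)
      qed
      show ?thesis
        unfolding eq PJ.emeasure_eq_measure indicator_simps(1)[OF True] mult_1_right
        by (rule ennreal_leI[OF ghost[OF True]])
    qed simp
  qed
  also have "\<dots> = emeasure (?P \<Otimes>\<^sub>M ?Q) (merge ?I ?J -` A \<inter> space (?P \<Otimes>\<^sub>M ?Q))"
    by (intro PJ.emeasure_pair_measure_alt[symmetric] measurable_sets[of _ _ ?R])
      (use measurable_merge[of ?I ?J "\<lambda>_. M"] A IJ in auto)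
  also have "\<dots> = emeasure (distr (?P \<Otimes>\<^sub>M ?Q) ?R (merge ?I ?J)) A"
    using measurable_merge[of ?I ?J "\<lambda>_. M"] A IJ by (subst emeasure_distr) auto
  also have "distr (?P \<Otimes>\<^sub>M ?Q) ?R (merge ?I ?J) = ?R"
    using prod.distr_merge[of ?I ?J] IJ by simp
  finally have "ennreal (1 / 2 * measure ?P E) \<le> ennreal (measure ?R A)"
    unfolding PI.emeasure_eq_measure PK.emeasure_eq_measure
    by (subst ennreal_mult) auto
  then have E_le: "measure ?P E \<le> 2 * measure ?R A"
    by (subst (asm) ennreal_le_iff) auto

  \<comment> \<open>An exchange permutes coordinates with equal marginals and so preserves the
    product measure; \<open>A\<close> can therefore be averaged over all exchanges.\<close>
  define \<tau> where "\<tau> S w = (\<lambda>j\<in>?K. w (swap_halves N S j) :: 'w)" for S w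
  have \<tau>: "\<tau> S \<in> ?R \<rightarrow>\<^sub>M ?R" "distr ?R ?R (\<tau> S) = ?R" if "S \<subseteq> ?I" for S
  proof -
    show "\<tau> S \<in> ?R \<rightarrow>\<^sub>M ?R"
      unfolding \<tau>_def using swap_halves_less[OF that]
      by (intro measurable_restrict measurable_component_singleton) auto
    show "distr ?R ?R (\<tau> S) = ?R"
      unfolding \<tau>_def using swap_halves_less[OF that] inj_on_swap_halves[OF that]
      by (intro distr_PiM_reindex[of ?K "\<lambda>_. M"] assms) auto
  qed
  have preA[measurable]: "\<tau> S -` A \<inter> space ?R \<in> sets ?R" if "S \<subseteq> ?I" for S
    using \<tau>(1)[OF that] A by (rule measurable_sets)
  define Good where "Good D = {S. S \<subseteq> ?I \<and> (\<forall>j<N. swap_halves N S j \<in> D) \<and>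
           k \<le> card {j \<in> ?J. swap_halves N S j \<notin> D}}" for D
  let ?c = "real \<Phi> * 2 ^ N / 2 ^ k"
  \<comment> \<open>An exchange sending \<open>w\<close> into \<open>A\<close> lies in
    \<open>Good D\<close>, where \<open>D\<close> is the trace on \<open>w\<close> of the set
    provided by \<open>sep\<close>. There are at most \<open>\<Phi>\<close> traces, each admitting
    at most \<open>2 ^ N / 2 ^ k\<close> exchanges.\<close>
  have pointwise: "(\<Sum>S\<in>Pow ?I. indicator (\<tau> S -` A \<inter> space ?R) w) \<le> ?c" for w
  proof -
    let ?T = "(\<lambda>C. {j \<in> ?K. w j \<in> C}) ` \<C>"
    have fin: "finite ?T" by (rule finite_subset[of _ "Pow ?K"]) auto
    have finG: "finite (Good D)" for D
      unfolding Good_def by (rule finite_subset[of _ "Pow ?I"]) auto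
    have "{S \<in> Pow ?I. w \<in> \<tau> S -` A \<inter> space ?R} \<subseteq> (\<Union>D\<in>?T. Good D)"
    proof
      fix S assume "S \<in> {S \<in> Pow ?I. w \<in> \<tau> S -` A \<inter> space ?R}"
      then have S: "S \<subseteq> ?I" and "\<tau> S w \<in> A" by auto
      then have vE: "restrict (\<tau> S w) ?I \<in> E"
        and vk: "k \<le> card {j \<in> ?J. (restrict (\<tau> S w) ?I, \<tau> S w j) \<in> W}"
        by (auto simp: A_def cnt)
      obtain C where C: "C \<in> \<C>" "\<And>i. i < N \<Longrightarrow> restrict (\<tau> S w) ?I i \<in> C"
        "\<And>v. v \<in> C \<Longrightarrow> (restrict (\<tau> S w) ?I, v) \<notin> W"
        using sep[OF vE] by blast
      let ?D = "{j \<in> ?K. w j \<in> C}"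
      have "\<forall>j<N. swap_halves N S j \<in> ?D"
      proof (intro allI impI)
        fix j assume "j < N"
        then show "swap_halves N S j \<in> ?D"
          using C(2)[of j] swap_halves_less[OF S, of j] by (simp add: \<tau>_def)
      qed
      moreover have "{j \<in> ?J. (restrict (\<tau> S w) ?I, \<tau> S w j) \<in> W} \<subseteq> {j \<in> ?J. swap_halves N S j \<notin> ?D}"
      proof
        fix j assume j: "j \<in> {j \<in> ?J. (restrict (\<tau> S w) ?I, \<tau> S w j) \<in> W}"
        then have "\<tau> S w j \<notin> C" using C(3) by blast
        then show "j \<in> {j \<in> ?J. swap_halves N S j \<notin> ?D}" using j by (simp add: \<tau>_def)
      qed
      then have "card {j \<in> ?J. (restrict (\<tau> S w) ?I, \<tau> S w j) \<in> W} \<le> card {j \<in> ?J. swap_halves N S j \<notin> ?D}"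
        by (intro card_mono) auto
      ultimately have "S \<in> Good ?D" using S vk unfolding Good_def by simp
      then show "S \<in> (\<Union>D\<in>?T. Good D)" using C(1) by blast
    qed
    then have "card {S \<in> Pow ?I. w \<in> \<tau> S -` A \<inter> space ?R} \<le> card (\<Union>D\<in>?T. Good D)"
      by (intro card_mono finite_UN_I fin finG)
    also have "\<dots> \<le> (\<Sum>D\<in>?T. card (Good D))" by (rule card_UN_le[OF fin])
    finally have "real (card {S \<in> Pow ?I. w \<in> \<tau> S -` A \<inter> space ?R}) \<le> (\<Sum>D\<in>?T. real (card (Good D)))"
      by (simp only: of_nat_sum[symmetric] of_nat_le_iff)
    also have "\<dots> \<le> (\<Sum>D\<in>?T. 2 ^ N / 2 ^ k)"
    proof (rule sum_mono)
      fix D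
      have "real (card (Good D) * 2 ^ k) \<le> real (2 ^ N)"
        using card_good_swaps[of N D k] unfolding Good_def of_nat_le_iff .
      then show "real (card (Good D)) \<le> 2 ^ N / 2 ^ k" by (simp add: field_simps)
    qed
    also have "\<dots> \<le> real \<Phi> * (2 ^ N / 2 ^ k)"
      using growth[of w] by (simp add: divide_right_mono mult_right_mono)
    also have "real (card {S \<in> Pow ?I. w \<in> \<tau> S -` A \<inter> space ?R})
        = (\<Sum>S\<in>Pow ?I. indicator (\<tau> S -` A \<inter> space ?R) w)"
      unfolding real_of_card
      by (rule sum.mono_neutral_cong_left) (auto simp: indicator_def)
    finally show ?thesis by (simp only: times_divide_eq_right)
  qed
  \<comment> \<open>Integrating the pointwise count: by invariance each of the \<open>2 ^ N\<close>
    exchanges contributes the measure of \<open>A\<close>.\<close>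
  have "2 ^ N * measure ?R A = (\<Sum>S\<in>Pow ?I. measure ?R A)"
    by (simp add: card_Pow)
  also have "\<dots> = (\<Sum>S\<in>Pow ?I. measure ?R (\<tau> S -` A \<inter> space ?R))"
  proof (rule sum.cong[OF refl])
    fix S assume "S \<in> Pow ?I"
    then show "measure ?R A = measure ?R (\<tau> S -` A \<inter> space ?R)"
      using measure_distr[OF \<tau>(1) A, of S] \<tau>(2)[of S] by simp
  qed
  also have "\<dots> = (\<integral>w. (\<Sum>S\<in>Pow ?I. indicator (\<tau> S -` A \<inter> space ?R) w) \<partial>?R)"
    using preA by (subst Bochner_Integration.integral_sum)
      (auto intro!: integrable_real_indicator simp: less_top[symmetric])
  also have "\<dots> \<le> (\<integral>w. ?c \<partial>?R)"
    using preA by (intro integral_mono pointwise Bochner_Integration.integrable_sum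
        integrable_real_indicator) (auto simp: less_top[symmetric])
  also have "\<dots> = ?c" by (simp add: PK.prob_space)
  finally have "measure ?R A \<le> real \<Phi> / 2 ^ k" by (simp add: field_simps)
  then show ?thesis using E_le by simp
qed

section \<open>Passing from completed measures to measurable versions\<close>

text \<open>Removing from the main part of \<open>E\<close> a null set that covers the exceptional
  points costs no measure. Almost sure conditions thus become conditions at every point of a
  measurable event.\<close>

lemma completion_inner_set:
  assumes E: "E \<in> sets (completion P)" and Q: "AE z in P. Q z"
  obtains E' where "E' \<in> sets P" "E' \<subseteq> E" "\<And>z. z \<in> E' \<Longrightarrow> Q z"
    "measure P E' = measure (completion P) E"
proof -
  from Q obtain N where N: "{z \<in> space P. \<not> Q z} \<subseteq> N" "N \<in> null_sets P"
    by (auto elim!: AE_E simp: null_sets_def)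
  let ?E' = "main_part P E - N"
  have main: "main_part P E \<in> sets P" "main_part P E \<subseteq> E"
    using E main_part_sets[OF E] main_part_null_part_Un[OF E] by blast+
  show ?thesis
  proof
    show "?E' \<in> sets P" "?E' \<subseteq> E" using main N by auto
    show "Q z" if "z \<in> ?E'" for z
      using that N(1) sets.sets_into_space[OF main(1)] by auto
    show "measure P ?E' = measure (completion P) E"
      using E main N by (simp add: measure_def emeasure_Diff_null_set)
  qed
qed

text \<open>The preimage of each set of a countable basis is measurable up to a null set. The union
  of these null sets is null, and sending it to one point of \<open>X\<close> repairs all preimages
  at once.\<close>

lemma completion_ex_measurable_AE_eq:
  fixes X :: "'a::second_countable_topology set"
  assumes f: "f \<in> completion P \<rightarrow>\<^sub>M restrict_space borel X" and "X \<noteq> {}"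
  obtains g where "g \<in> P \<rightarrow>\<^sub>M restrict_space borel X" "AE z in P. f z = g z"
proof -
  obtain x0 where x0: "x0 \<in> X" using \<open>X \<noteq> {}\<close> by auto
  obtain B :: "'a set set" where B: "countable B" "topological_basis B"
    using ex_countable_basis by auto
  have fborel: "f \<in> completion P \<rightarrow>\<^sub>M borel" and fX: "f \<in> space P \<rightarrow> X"
    using f by (auto simp: measurable_restrict_space2_iff)
  let ?S = "\<lambda>b. f -` b \<inter> space P"
  have S: "?S b \<in> sets (completion P)" if "b \<in> B" for b
    using measurable_sets[OF fborel, of b] B that by (auto simp: topological_basis_open)
  then have "\<forall>b\<in>B. \<exists>N. N \<in> null_sets P \<and> null_part P (?S b) \<subseteq> N"
    using null_part by blast
  then obtain N where N: "\<And>b. b \<in> B \<Longrightarrow> N b \<in> null_sets P"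
    "\<And>b. b \<in> B \<Longrightarrow> null_part P (?S b) \<subseteq> N b"
    by metis
  define Z where "Z = (\<Union>b\<in>B. N b)"
  have Z: "Z \<in> null_sets P" unfolding Z_def using B N by (intro null_sets_UN') auto
  define g where "g z = (if z \<in> Z then x0 else f z)" for z
  have "g \<in> P \<rightarrow>\<^sub>M borel"
    unfolding borel_eq_countable_basis[OF B]
  proof (rule measurable_measure_of)
    fix b assume b: "b \<in> B"
    have "?S b = main_part P (?S b) \<union> null_part P (?S b)"
      using main_part_null_part_Un[OF S[OF b]] by simp
    moreover have "null_part P (?S b) \<subseteq> Z" using N(2)[OF b] b by (auto simp: Z_def)
    ultimately have eq: "?S b - Z = main_part P (?S b) - Z" by auto
    have "g -` b \<inter> space P = (?S b - Z) \<union> (if x0 \<in> b then Z else {})"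
      using Z[THEN null_setsD2, THEN sets.sets_into_space] by (auto simp: g_def split: if_splits)
    also have "\<dots> \<in> sets P" unfolding eq using S[OF b] Z by auto
    finally show "g -` b \<inter> space P \<in> sets P" .
  qed auto
  moreover have "g \<in> space P \<rightarrow> X" using fX x0 by (auto simp: g_def)
  ultimately have "g \<in> P \<rightarrow>\<^sub>M restrict_space borel X" by (simp add: measurable_restrict_space2)
  moreover have "AE z in P. f z = g z"
    using AE_not_in[OF Z] by eventually_elim (simp add: g_def)
  ultimately show ?thesis by (rule that)
qed

text \<open>\<open>G'\<close> is the measurable part of \<open>G\<close>. By Fubini the null set
  covering the rest has null slices at almost every \<open>x\<close>.\<close>

lemma completion_pair_inner_slices:
  assumes "prob_space M" "prob_space \<mu>" and G: "G \<in> sets (completion (M \<Otimes>\<^sub>M \<mu>))"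
  obtains G' where "G' \<in> sets (M \<Otimes>\<^sub>M \<mu>)" "G' \<subseteq> G"
    "AE x in \<mu>. measure M ((\<lambda>w. (w, x)) -` G) \<le> measure M ((\<lambda>w. (w, x)) -` G')"
proof -
  interpret M: prob_space M by fact
  interpret \<mu>: prob_space \<mu> by fact
  interpret pair_sigma_finite M \<mu> ..
  obtain S N N' where split: "G = S \<union> N" "N \<subseteq> N'" "N' \<in> null_sets (M \<Otimes>\<^sub>M \<mu>)" "S \<in> sets (M \<Otimes>\<^sub>M \<mu>)"
    using G by (rule sets_completionE)
  have N': "N' \<in> sets (M \<Otimes>\<^sub>M \<mu>)" using split(3) by auto
  have "(\<integral>\<^sup>+x. emeasure M ((\<lambda>w. (w, x)) -` N') \<partial>\<mu>) = 0"
    using emeasure_pair_measure_alt2[OF N'] split(3) by auto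
  then have "AE x in \<mu>. emeasure M ((\<lambda>w. (w, x)) -` N') = 0"
    using measurable_emeasure_Pair2[OF N'] by (subst (asm) nn_integral_0_iff_AE) auto
  then have "AE x in \<mu>. measure M ((\<lambda>w. (w, x)) -` G) \<le> measure M ((\<lambda>w. (w, x)) -` S)"
  proof eventually_elim
    case (elim x)
    have sl: "(\<lambda>w. (w, x)) -` S \<in> sets M" "(\<lambda>w. (w, x)) -` N' \<in> null_sets M"
      using sets_Pair2[OF split(4)] sets_Pair2[OF N'] elim by auto
    \<comment> \<open>Slices of \<open>G\<close> may fail to be measurable here; monotonicity asks
      this only of the larger set, as \<open>measure\<close> is 0 outside
      \<open>sets M\<close>.\<close>
    have "measure M ((\<lambda>w. (w, x)) -` G) \<le> measure M ((\<lambda>w. (w, x)) -` S \<union> (\<lambda>w. (w, x)) -` N')"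
      using sl split(1,2) by (intro M.finite_measure_mono) auto
    also have "\<dots> = measure M ((\<lambda>w. (w, x)) -` S)"
      using sl by (intro measure_Un_null_set)
    finally show ?case .
  qed
  then show ?thesis using split(1,4) by (intro that[of S]) auto
qed

section \<open>Dimension zero and the assembly of the violation bound\<close>

text \<open>Were \<open>f s x = \<infinity>\<close>, the singleton \<open>{s}\<close> would be
  shattered: the feasible scenarios of \<open>x\<close> miss \<open>s\<close>, while
  \<open>Xi\<close>, adjoined to the class, contains it.\<close>

lemma feasibility_class_vc_dim_0:
  assumes "vc_dim (feasibility_class Xi X f) = 0" and "s \<in> Xi" "x \<in> X"
  shows "f s x < \<infinity>"
proof (rule ccontr)
  let ?C = "{s \<in> Xi. f s x < \<infinity>}"
  assume *: "\<not> f s x < \<infinity>"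
  have "shatters (feasibility_class Xi X f) {s}"
    unfolding shatters_def
  proof (intro allI impI)
    fix D assume "D \<subseteq> {s}"
    then consider "D = {}" | "D = {s}" by blast
    then show "\<exists>C\<in>feasibility_class Xi X f. D \<subseteq> C \<and> ({s} - D) \<inter> C = {}"
    proof cases
      case 1
      have "?C \<in> feasibility_class Xi X f" using \<open>x \<in> X\<close> by (auto simp: feasibility_class_def)
      moreover have "D \<subseteq> ?C \<and> ({s} - D) \<inter> ?C = {}" using * 1 by simp
      ultimately show ?thesis by (rule bexI[rotated])
    next
      case 2
      have "Xi \<in> feasibility_class Xi X f" by (auto simp: feasibility_class_def)
      moreover have "D \<subseteq> Xi \<and> ({s} - D) \<inter> Xi = {}" using \<open>s \<in> Xi\<close> 2 by simp
      ultimately show ?thesis by (rule bexI[rotated])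
    qed
  qed
  then have "enat (card {s}) \<le> vc_dim (feasibility_class Xi X f)"
    unfolding vc_dim_def by (intro SUP_upper) auto
  then show False using assms(1) by (simp add: zero_enat_def)
qed

theorem corollary3p4:
  fixes M :: "'w measure"
    and \<xi> :: "'w \<Rightarrow> real ^ 'r"
    and Xi :: "(real ^ 'r) set"
    and X :: "'a::polish_space set"
    and f :: "real ^ 'r \<Rightarrow> 'a \<Rightarrow> ereal"
    and x_star :: "(nat \<Rightarrow> real ^ 'r) \<Rightarrow> 'a"
    and N d :: nat
    and \<epsilon> :: real
  assumes "prob_space M" and "complete_measure M"
    and "\<xi> \<in> M \<rightarrow>\<^sub>M restrict_space borel Xi"
    and "X \<noteq> {}" and "closed X"
    and "\<And>s x. s \<in> Xi \<Longrightarrow> x \<in> X \<Longrightarrow> f s x \<noteq> - \<infinity>"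
    and "\<And>\<omega>. \<omega> \<in> space M \<Longrightarrow> lsc_on X (f (\<xi> \<omega>))"
    and "jointly_measurable M \<xi> X f"
    and "{x \<in> X. objective M \<xi> f x < \<infinity>} \<noteq> {}"
    and "vc_dim (feasibility_class Xi X f) = enat d"
    and "N > 0"
    and "AE z in sample_law M \<xi> Xi N. saa_feasible X N z f \<noteq> {}"
    and "x_star \<in> sample_law M \<xi> Xi N \<rightarrow>\<^sub>M restrict_space borel X"
    and "\<And>z. z \<in> space (sample_law M \<xi> Xi N) \<Longrightarrow> saa_feasible X N z f \<noteq> {} \<Longrightarrow>
           x_star z \<in> saa_feasible X N z f"
    and "0 < \<epsilon>" and "\<epsilon> < 1"
  shows "measure (sample_law M \<xi> Xi N)
           {z \<in> space (sample_law M \<xi> Xi N). violation M \<xi> X f (x_star z) > \<epsilon>}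
         \<le> 2 * exp (- (real N * \<epsilon> / 4)) * (12 / \<epsilon>) ^ d"
proof -
  let ?H = "feasibility_class Xi X f"
  let ?D = "distr M (restrict_space borel Xi) \<xi>"
  let ?I = "{..<N}" and ?J = "{N..<2 * N}"
  let ?P = "PiM ?I (\<lambda>_. ?D)" and ?Q = "PiM ?I (\<lambda>_. M)" and ?QJ = "PiM ?J (\<lambda>_. M)"
  let ?rhs = "2 * exp (- (real N * \<epsilon> / 4)) * (12 / \<epsilon>) ^ d"
  define E where "E = {z \<in> space (sample_law M \<xi> Xi N). violation M \<xi> X f (x_star z) > \<epsilon>}"
  interpret M: prob_space M by fact
  note \<xi>[measurable] = assms(3)
  interpret D: prob_space ?D by (rule M.prob_space_distr[OF \<xi>])
  interpret P: prob_space ?P by (intro prob_space_PiM D.prob_space_axioms)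
  interpret C: prob_space "completion ?P" by (rule P.prob_space_completion)
  have law: "sample_law M \<xi> Xi N = completion ?P" by (simp add: sample_law_def)
  have \<xi>_Xi: "\<xi> w \<in> Xi" if "w \<in> space M" for w
    using measurable_space[OF \<xi> that] by (simp add: space_restrict_space)
  have rhs_nonneg: "0 \<le> ?rhs" using assms(15) by simp
  have x_star: "x_star \<in> completion ?P \<rightarrow>\<^sub>M restrict_space borel X" using assms(13) by (simp add: law)
  have x_star_X: "x_star z \<in> X" if "z \<in> space ?P" for z
    using measurable_space[OF x_star, of z] that by (simp add: space_restrict_space)

  \<comment> \<open>A set outside the completed sigma-algebra has \<open>measure\<close> 0 by
    default. For \<open>d = 0\<close> no decision in \<open>X\<close> is ever violated, and for
    \<open>N * \<epsilon> < 8 * d\<close> the right-hand side is at least 1. Double sampling handles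
    the last case.\<close>
  consider (null) "E \<notin> sets (completion ?P)" | (zero) "d = 0"
    | (trivial) "0 < d" "real N * \<epsilon> < 8 * real d"
    | (main) "E \<in> sets (completion ?P)" "0 < d" "8 * real d \<le> real N * \<epsilon>"
    by linarith
  then have "measure (completion ?P) E \<le> ?rhs"
  proof cases
    case null
    then show ?thesis using rhs_nonneg by (simp add: measure_notin_sets)
  next
    case zero
    have "violation M \<xi> X f x = 0" if "x \<in> X" for x
    proof -
      have "{w \<in> space M. x \<notin> eff_dom X (f (\<xi> w))} = {}"
        using feasibility_class_vc_dim_0[of Xi X f _ x] assms(10) zero that \<xi>_Xi
        by (auto simp: eff_dom_def zero_enat_def)
      then show ?thesis by (simp only: violation_def measure_empty)
    qed
    then have "E = {}" using x_star_X assms(15) by (auto simp: E_def law)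
    then show ?thesis using rhs_nonneg by simp
  next
    case trivial
    \<comment> \<open>Here \<open>N * \<epsilon> / 4 < 2 * d\<close> and
      \<open>12 / \<epsilon> \<ge> 12\<close>, so this inequality, raised to the power
      \<open>d\<close>, makes the bound trivial.\<close>
    have "1 \<le> exp (- 2) * (12 :: real)"
    proof -
      have "exp 2 = exp (1 :: real) ^ 2" by (simp flip: exp_of_nat_mult)
      also have "\<dots> \<le> 3 ^ 2" using exp_le by (intro power_mono) auto
      finally have "exp (2 :: real) \<le> 12" by simp
      then show ?thesis by (simp add: exp_minus field_simps)
    qed
    then have "1 \<le> (exp (- 2) * 12 :: real) ^ d" by (rule one_le_power)
    also have "\<dots> = exp (- (2 * real d)) * 12 ^ d"
      by (simp add: power_mult_distrib mult.commute flip: exp_of_nat_mult)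
    also have "\<dots> \<le> exp (- (real N * \<epsilon> / 4)) * (12 / \<epsilon>) ^ d"
      using trivial assms(15,16) by (intro mult_mono power_mono) (auto simp: field_simps)
    finally have "1 \<le> ?rhs" by simp
    then show ?thesis using C.prob_le_1[of E] by linarith
  next
    case main
    \<comment> \<open>Joint measurability is invoked for the law of the selected decision, so that
      almost every decision translates into almost every sample.\<close>
    define \<mu> where "\<mu> = distr (completion ?P) (restrict_space borel X) x_star"
    have \<mu>: "prob_space \<mu>" unfolding \<mu>_def by (rule C.prob_space_distr[OF x_star])
    have sets_\<mu>: "sets \<mu> = sets (restrict_space borel X)" by (simp add: \<mu>_def)
    have space_\<mu>: "space \<mu> = X" using sets_eq_imp_space_eq[OF sets_\<mu>] by (simp add: space_restrict_space)
    define G where "G = (\<lambda>(w, x). f (\<xi> w) x) -` {\<infinity>} \<inter> space (M \<Otimes>\<^sub>M \<mu>)"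
    have "(\<lambda>(w, x). f (\<xi> w) x) \<in> borel_measurable (completion (M \<Otimes>\<^sub>M \<mu>))"
      using assms(8) \<mu> sets_\<mu> unfolding jointly_measurable_def by blast
    from measurable_sets[OF this, of "{\<infinity>}"] have G: "G \<in> sets (completion (M \<Otimes>\<^sub>M \<mu>))"
      by (simp add: G_def)
    obtain G' where G': "G' \<in> sets (M \<Otimes>\<^sub>M \<mu>)" "G' \<subseteq> G"
      "AE x in \<mu>. measure M ((\<lambda>w. (w, x)) -` G) \<le> measure M ((\<lambda>w. (w, x)) -` G')"
      using completion_pair_inner_slices[OF M.prob_space_axioms \<mu> G] .
    have slices: "AE z in ?P. measure M ((\<lambda>w. (w, x_star z)) -` G) \<le> measure M ((\<lambda>w. (w, x_star z)) -` G')"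
      using AE_distrD[OF x_star G'(3)[unfolded \<mu>_def]] by (simp only: AE_completion_iff)
    obtain g where g: "g \<in> ?P \<rightarrow>\<^sub>M restrict_space borel X" "AE z in ?P. x_star z = g z"
      using completion_ex_measurable_AE_eq[OF x_star assms(4)] .
    have feasible: "AE z in ?P. saa_feasible X N z f \<noteq> {}"
      using assms(12) by (simp only: law AE_completion_iff)
    obtain E' where E': "E' \<in> sets ?P" "E' \<subseteq> E" "measure ?P E' = measure (completion ?P) E"
      and good: "\<And>z. z \<in> E' \<Longrightarrow> measure M ((\<lambda>w. (w, x_star z)) -` G) \<le> measure M ((\<lambda>w. (w, x_star z)) -` G')
        \<and> x_star z = g z \<and> saa_feasible X N z f \<noteq> {}"
    proof (rule completion_inner_set[OF main(1)])
      show "AE z in ?P. measure M ((\<lambda>w. (w, x_star z)) -` G) \<le> measure M ((\<lambda>w. (w, x_star z)) -` G')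
        \<and> x_star z = g z \<and> saa_feasible X N z f \<noteq> {}"
        using slices g(2) feasible by eventually_elim blast
    qed blast
    \<comment> \<open>Joint measurability refers to outcomes in \<open>M\<close> rather than to
      values of \<open>\<xi>\<close>. The samples are therefore drawn from \<open>M\<close> and
      mapped coordinatewise by \<open>\<xi>\<close>, which carries \<open>?Q\<close> to
      \<open>?P\<close>.\<close>
    define h where "h = compose ?I \<xi>"
    have h[measurable]: "h \<in> ?Q \<rightarrow>\<^sub>M PiM ?I (\<lambda>_. restrict_space borel Xi)"
      unfolding h_def compose_def by measurable
    have "distr ?Q (PiM ?I (\<lambda>_. ?D)) h = PiM ?I (\<lambda>_. distr M ?D \<xi>)"
      unfolding h_def by (intro distr_PiM_finite_prob_space' M.prob_space_axioms D.prob_space_axioms) auto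
    moreover have "distr M ?D \<xi> = ?D" by (rule distr_cong) auto
    ultimately have distr_h: "distr ?Q ?P h = ?P" by simp
    have h_P: "h \<in> ?Q \<rightarrow>\<^sub>M ?P"
      using h by (simp cong: measurable_cong_sets sets_PiM_cong)
    define F where "F = h -` E' \<inter> space ?Q"
    have F: "F \<in> sets ?Q" unfolding F_def using h_P E'(1) by (rule measurable_sets)
    have F_measure: "measure ?Q F = measure ?P E'"
      using measure_distr[OF h_P E'(1)] by (simp add: distr_h F_def)
    \<comment> \<open>A measurable subset of the event that the decision selected from
      \<open>h \<omega>\<close> is violated at \<open>w\<close>.\<close>
    define W where "W = (\<lambda>(\<omega>, w). (w, g (h \<omega>))) -` G' \<inter> space (?Q \<Otimes>\<^sub>M M)"
    have gh: "(\<lambda>\<omega>. g (h \<omega>)) \<in> ?Q \<rightarrow>\<^sub>M \<mu>"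
      using measurable_compose[OF h_P g(1)] by (simp cong: measurable_cong_sets add: sets_\<mu>)
    have "(\<lambda>(\<omega>, w). (w, g (h \<omega>))) \<in> ?Q \<Otimes>\<^sub>M M \<rightarrow>\<^sub>M M \<Otimes>\<^sub>M \<mu>"
      using gh by measurable
    then have W: "W \<in> sets (?Q \<Otimes>\<^sub>M M)" unfolding W_def using G'(1) by (rule measurable_sets)
    \<comment> \<open>A trace of \<open>\<C>\<close> at points \<open>p\<close> is a trace of
      \<open>?H\<close> at \<open>\<xi> \<circ> p\<close>, so the growth bound carries over.\<close>
    define \<C> where "\<C> = (\<lambda>C. \<xi> -` C) ` ?H"
    \<comment> \<open>Rounding up loses nothing because the hit counts are integers.\<close>
    define k where "k = nat \<lceil>3 / 5 * \<epsilon> * real N\<rceil>"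
    have F_D: "\<omega> \<in> space ?Q" "h \<omega> \<in> E'" "x_star (h \<omega>) = g (h \<omega>)" "g (h \<omega>) \<in> X" if "\<omega> \<in> F" for \<omega>
      using that good[of "h \<omega>"] measurable_space[OF gh, of \<omega>] by (auto simp: F_def space_\<mu>)
    have "measure ?Q F \<le> 2 * real (\<Sum>i\<le>d. (2 * N) choose i) / 2 ^ k"
    proof (rule measure_le_symmetrization[OF M.prob_space_axioms F W, where \<C> = \<C>])
      fix \<omega> assume \<omega>: "\<omega> \<in> F"
      let ?x = "g (h \<omega>)"
      let ?B = "(\<lambda>w. (w, ?x)) -` G'"
      have B: "?B \<in> sets M" using G'(1) by (rule sets_Pair2)
      have viol: "{w \<in> space M. ?x \<notin> eff_dom X (f (\<xi> w))} = (\<lambda>w. (w, ?x)) -` G"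
        using F_D(4)[OF \<omega>] by (auto simp: G_def eff_dom_def space_pair_measure space_\<mu>)
      have "h \<omega> \<in> E" using F_D(2)[OF \<omega>] E'(2) by blast
      then have "\<epsilon> < violation M \<xi> X f ?x" using F_D(3)[OF \<omega>] by (simp add: E_def)
      also have "\<dots> = measure M ((\<lambda>w. (w, ?x)) -` G)" by (simp only: violation_def viol)
      also have "\<dots> \<le> measure M ?B" using good[OF F_D(2)[OF \<omega>]] F_D(3)[OF \<omega>] by simp
      finally have \<epsilon>_le: "\<epsilon> \<le> measure M ?B" by simp
      \<comment> \<open>The condition \<open>8 \<le> card ?J * \<epsilon>\<close> of the Chernoff
        bound follows from \<open>8 * d \<le> N * \<epsilon>\<close> and
        \<open>d \<ge> 1\<close>.\<close>
      have "1 / 2 \<le> measure ?QJ {y \<in> space ?QJ.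
          3 / 5 * \<epsilon> * real (card ?J) \<le> real (card {j \<in> ?J. y j \<in> ?B})}"
        using main \<epsilon>_le assms(15)
        by (intro half_le_measure_many_hits M.prob_space_axioms B) auto
      also have "{y \<in> space ?QJ. 3 / 5 * \<epsilon> * real (card ?J) \<le> real (card {j \<in> ?J. y j \<in> ?B})}
          = {y \<in> space ?QJ. k \<le> card {j \<in> ?J. (\<omega>, y j) \<in> W}}"
      proof (rule Collect_cong, rule conj_cong[OF refl])
        fix y assume y: "y \<in> space ?QJ"
        have "{j \<in> ?J. y j \<in> ?B} = {j \<in> ?J. (\<omega>, y j) \<in> W}"
          using y F_D(1)[OF \<omega>] by (auto simp: W_def space_pair_measure space_PiM PiE_def)
        then show "3 / 5 * \<epsilon> * real (card ?J) \<le> real (card {j \<in> ?J. y j \<in> ?B})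
            \<longleftrightarrow> k \<le> card {j \<in> ?J. (\<omega>, y j) \<in> W}"
          unfolding k_def by (simp add: nat_le_iff ceiling_le_iff)
      qed
      finally show "1 / 2 \<le> measure ?QJ {y \<in> space ?QJ. k \<le> card {j \<in> ?J. (\<omega>, y j) \<in> W}}" .
      \<comment> \<open>The separating set consists of the scenarios feasible for the selected
        decision: the sample lies in it because the algorithm's output is feasible, and
        \<open>W\<close> avoids it because \<open>G' \<subseteq> G\<close>.\<close>
      let ?C = "{s \<in> Xi. f s ?x < \<infinity>}"
      have "\<xi> -` ?C \<in> \<C>" using F_D(4)[OF \<omega>] unfolding \<C>_def feasibility_class_def by blast
      moreover have "\<forall>i<N. \<omega> i \<in> \<xi> -` ?C"
      proof (intro allI impI)
        fix i assume i: "i < N"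
        have "h \<omega> \<in> E" using F_D(2)[OF \<omega>] E'(2) by blast
        then have "h \<omega> \<in> space (sample_law M \<xi> Xi N)" by (simp add: E_def)
        then have "?x \<in> saa_feasible X N (h \<omega>) f"
          using assms(14)[of "h \<omega>"] good[OF F_D(2)[OF \<omega>]] by simp
        then have "f (h \<omega> i) ?x < \<infinity>"
          using i unfolding saa_feasible_eq_INT[OF assms(11)] by (auto simp: eff_dom_def)
        moreover have "h \<omega> i = \<xi> (\<omega> i)" using i by (simp add: h_def compose_def)
        moreover have "\<omega> i \<in> space M" using F_D(1)[OF \<omega>] i by (auto simp: space_PiM)
        ultimately show "\<omega> i \<in> \<xi> -` ?C" using \<xi>_Xi by simp
      qed
      moreover have "\<forall>w\<in>\<xi> -` ?C. (\<omega>, w) \<notin> W"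
      proof (intro ballI notI)
        fix w assume "w \<in> \<xi> -` ?C" and "(\<omega>, w) \<in> W"
        then have "(w, ?x) \<in> G" using G'(2) by (auto simp: W_def)
        then show False using \<open>w \<in> \<xi> -` ?C\<close> by (simp add: G_def)
      qed
      ultimately show "\<exists>C\<in>\<C>. (\<forall>i<N. \<omega> i \<in> C) \<and> (\<forall>w\<in>C. (\<omega>, w) \<notin> W)"
        by (intro bexI[of _ "\<xi> -` ?C"] conjI)
    next
      fix p :: "nat \<Rightarrow> 'w"
      have "card ((\<lambda>C. {j \<in> {..<2 * N}. (\<xi> \<circ> p) j \<in> C}) ` ?H) \<le> (\<Sum>i\<le>d. card {..<2 * N} choose i)"
        by (rule sauer_shelah_traces[OF _ assms(10)]) simp
      then show "card ((\<lambda>C. {j \<in> {..<2 * N}. p j \<in> C}) ` \<C>) \<le> (\<Sum>i\<le>d. (2 * N) choose i)"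
        by (simp add: \<C>_def image_image)
    qed
    also have "\<dots> \<le> 2 * ((exp 1 * real (2 * N) / real d) ^ d * 2 powr (- (3 / 5 * \<epsilon> * real N)))"
    proof -
      \<comment> \<open>The binomial estimate requires \<open>d \<le> 2 * N\<close>, which follows
        from \<open>8 * d \<le> N * \<epsilon> \<le> N\<close>.\<close>
      have "real N * \<epsilon> \<le> real N" using assms(15,16) by (simp add: mult_left_le)
      then have "d \<le> 2 * N" using main by linarith
      then have "real (\<Sum>i\<le>d. (2 * N) choose i) \<le> (exp 1 * real (2 * N) / real d) ^ d"
        using main by (intro sum_binomial_le_exp)
      moreover have "1 / 2 ^ k \<le> 2 powr (- (3 / 5 * \<epsilon> * real N))"
      proof -
        have "3 / 5 * \<epsilon> * real N \<le> real k" unfolding k_def by (rule real_nat_ceiling_ge)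
        then have "2 powr (- real k) \<le> 2 powr (- (3 / 5 * \<epsilon> * real N))" by (intro powr_mono) linarith+
        then show ?thesis unfolding powr_minus_divide by (simp add: powr_realpow)
      qed
      ultimately have "real (\<Sum>i\<le>d. (2 * N) choose i) * (1 / 2 ^ k)
          \<le> (exp 1 * real (2 * N) / real d) ^ d * 2 powr (- (3 / 5 * \<epsilon> * real N))"
        by (intro mult_mono) auto
      then show ?thesis by simp
    qed
    also have "\<dots> \<le> ?rhs"
      using vc_numeric_bound[OF main(2) assms(15) main(3)] by simp
    finally show ?thesis using F_measure E'(3) by simp
  qed
  then show ?thesis by (simp only: law E_def)
qed

end
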